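(* For nonnegative integers $r,s,n$, let $S(r,s;n)$ denote the number of partitions $\pi$ of $n$ such that $\pi$ has exactly $r$ odd parts and the conjugate partition $\pi'$ has exactly $s$ odd parts. Then, as an identity of formal power series in $q$ with coefficients in $\mathbb{Z}[y,z]$, $$\sum_{n,r,s\geq 0} S(r,s;n)\, z^r y^s q^n = \prod_{j=1}^\infty \frac{1+yzq^{2j-1}}{(1-q^{4j})(1-z^2 q^{4j-2})(1-y^2 q^{4j-2})}.$$
   Context: A partition $\pi$ of an integer $n\geq 0$ is a nonincreasing sequence $\pi=(\pi_1,\pi_2,\pi_3,\dots)$ of nonnegative integers with only finitely many nonzero terms and $\sum_{i\geq 1}\pi_i=n$; trailing zeros may be omitted. The nonzero terms $\pi_i$ are the parts of $\pi$. The multiplicity $m_i(\pi)$ of a positive integer $i$ is the number of parts of $\pi$ equal to $i$. The number of odd parts of $\pi$ is the number of indices $i$ with $\pi_i$ odd (i.e. odd parts are counted with multiplicity). The conjugate of $\pi$ is the partition $\pi'=(\pi'_1,\pi'_2,\dots)$ with $\pi'_i=\sum_{j\geq i} m_j(\pi)$ for $i\geq 1$ (equivalently, the transpose of the Young diagram of $\pi$). *)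

theory Defs
  imports "HOL-Analysis.Analysis" "HOL-Computational_Algebra.Computational_Algebra"
begin

text \<open>Sequences are indexed from 0: the part written \<open>\<pi>\<^sub>i\<close> (with \<open>i \<ge> 1\<close>) is \<open>\<pi> (i - 1)\<close>.\<close>

definition partition_of :: "(nat \<Rightarrow> nat) \<Rightarrow> nat \<Rightarrow> bool" where
  "partition_of \<pi> n \<longleftrightarrow>
     antimono \<pi> \<and> finite {i. \<pi> i \<noteq> 0} \<and> (\<Sum>i | \<pi> i \<noteq> 0. \<pi> i) = n"

text \<open>Only meaningful for positive \<open>j\<close>; the value 0 occurs infinitely often in a partition.\<close>

definition part_mult :: "(nat \<Rightarrow> nat) \<Rightarrow> nat \<Rightarrow> nat" where
  "part_mult \<pi> j = card {i. \<pi> i = j}"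

text \<open>By the index shift, \<open>conjugate \<pi> i\<close> is \<open>\<pi>'\<^bsub>i+1\<^esub>\<close>, the sum of the multiplicities of
  all \<open>j \<ge> i + 1\<close>.  The sum is restricted to the finitely many nonzero terms.\<close>

definition conjugate :: "(nat \<Rightarrow> nat) \<Rightarrow> nat \<Rightarrow> nat" where
  "conjugate \<pi> i = (\<Sum>j | j \<ge> i + 1 \<and> part_mult \<pi> j \<noteq> 0. part_mult \<pi> j)"

definition num_odd_parts :: "(nat \<Rightarrow> nat) \<Rightarrow> nat" where
  "num_odd_parts \<pi> = card {i. odd (\<pi> i)}"

definition S :: "nat \<Rightarrow> nat \<Rightarrow> nat \<Rightarrow> nat" where
  "S r s n = card {\<pi>. partition_of \<pi> n \<and> num_odd_parts \<pi> = r \<and> num_odd_parts (conjugate \<pi>) = s}"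

text \<open>The ring \<open>\<int>[y,z]\<close> is modelled as \<open>\<int>[z][y]\<close>.\<close>

definition y_var :: "int poly poly" where
  "y_var = [:0, 1:]"

definition z_var :: "int poly poly" where
  "z_var = [:[:0, 1:]:]"

definition gf_term :: "nat \<Rightarrow> nat \<Rightarrow> nat \<Rightarrow> int poly poly fps" where
  "gf_term n r s = fps_const (of_nat (S r s n) * z_var ^ r * y_var ^ s) * fps_X ^ n"

text \<open>Polynomial coefficients carry no \<^class>\<open>inverse\<close> operation, so the reciprocal of a power
  series with constant coefficient 1 is written \<^term>\<open>\<lambda>f. fps_right_inverse f 1\<close>, where 1 is
  the inverse of that constant coefficient.\<close>

definition gf_factor :: "nat \<Rightarrow> int poly poly fps" where
  "gf_factor j =
     (1 + fps_const (y_var * z_var) * fps_X ^ (2 * j - 1)) *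
     fps_right_inverse
       ((1 - fps_X ^ (4 * j)) *
        (1 - fps_const (z_var ^ 2) * fps_X ^ (4 * j - 2)) *
        (1 - fps_const (y_var ^ 2) * fps_X ^ (4 * j - 2))) 1"

end

theory Submission
  imports Defs
begin

text \<open>
  Give a partition the weight \<open>q\<^sup>n z\<^sup>r y\<^sup>s\<close>.  A column of odd length ends in an odd-numbered row, so
  \<open>s = (\<pi>\<^sub>1 - \<pi>\<^sub>2) + (\<pi>\<^sub>3 - \<pi>\<^sub>4) + \<dots>\<close>; like \<open>n\<close> and \<open>r\<close>, this is a sum of contributions of the pairs
  \<open>(\<pi>\<^bsub>2i-1\<^esub>, \<pi>\<^bsub>2i\<^esub>)\<close>.  The product formula then comes from two decompositions.

  First, as long as \<open>\<pi>\<^bsub>2j-1\<^esub> - \<pi>\<^bsub>2j\<^esub> \<ge> 2\<close>, two columns of length \<open>2 j - 1\<close> can be removed.  This lowers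
  \<open>s\<close> by 2, lowers \<open>n\<close> by \<open>4 j - 2\<close> and preserves the parity of every part.  Doing so for all \<open>j\<close>
  splits off the factors \<open>1 / (1 - y\<^sup>2 q\<^bsup>4j-2\<^esup>)\<close> and leaves the \<^emph>\<open>narrow\<close> partitions, in which
  \<open>\<pi>\<^bsub>2j-1\<^esub> - \<pi>\<^bsub>2j\<^esub> \<le> 1\<close> for all \<open>j\<close> (lemma \<open>gf_narrow_up_to\<close>).

  Second, a narrow partition is determined by the sums \<open>t\<^sub>j = \<pi>\<^bsub>2j-1\<^esub> + \<pi>\<^bsub>2j\<^esub>\<close>, and the sequences \<open>t\<close> that
  occur are exactly the partitions whose odd parts are distinct: below a pair \<open>(a, a)\<close> another pair
  \<open>(a, a)\<close> is possible, but a pair \<open>(a + 1, a)\<close> cannot lie below a copy of itself.  A part \<open>2 a + 1\<close>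
  of \<open>t\<close> contributes \<open>y z q\<^bsup>2a+1\<^esup>\<close>, a part \<open>2 a\<close> contributes \<open>z\<^sup>2 q\<^bsup>2a\<^esup>\<close> if \<open>a\<close> is odd and \<open>q\<^bsup>2a\<^esup>\<close> if
  \<open>a\<close> is even, which gives the remaining factors.  The partition \<open>t\<close> stays implicit in the proof:
  its parts are split off from the largest one downwards, by removing the first two rows of
  \<open>\<pi>\<close> (lemma \<open>gf_narrow_le_even\<close>).

  Both steps are exact identities for finitely many factors.  Since a partition of \<open>n\<close> has at most
  \<open>n\<close> parts, each at most \<open>n\<close>, they combine to a congruence modulo \<open>q\<^sup>N\<close> between the generating
  function and the product of the first \<open>N\<close> factors (lemma \<open>prod_gf_factor_agrees\<close>), and this is
  convergence in the topology of formal power series.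
\<close>

section \<open>Partitions and their statistics in terms of pairs of consecutive parts\<close>

definition partitions :: "(nat \<Rightarrow> nat) set" where
  "partitions = {\<pi>. antimono \<pi> \<and> finite {i. \<pi> i \<noteq> 0}}"

definition part_sum :: "(nat \<Rightarrow> nat) \<Rightarrow> nat" where
  "part_sum \<pi> = (\<Sum>i | \<pi> i \<noteq> 0. \<pi> i)"

lemma partition_of_iff: "partition_of \<pi> n \<longleftrightarrow> \<pi> \<in> partitions \<and> part_sum \<pi> = n"
  by (auto simp: partition_of_def partitions_def part_sum_def)

lemma partitionsD: "\<pi> \<in> partitions \<Longrightarrow> i \<le> j \<Longrightarrow> \<pi> j \<le> \<pi> i"
  by (auto simp: partitions_def antimono_def)

lemma partitionsI:
  assumes "\<And>i. \<pi> (Suc i) \<le> \<pi> i" and "\<And>i. i \<ge> N \<Longrightarrow> \<pi> i = 0"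
  shows "\<pi> \<in> partitions"
proof -
  have "{i. \<pi> i \<noteq> 0} \<subseteq> {..<N}"
    using assms(2) by (auto intro: ccontr)
  then have "finite {i. \<pi> i \<noteq> 0}"
    by (rule finite_subset) simp
  with assms(1) show ?thesis
    by (auto simp: partitions_def antimono_iff_le_Suc)
qed

lemma part_le_part_sum: "\<pi> \<in> partitions \<Longrightarrow> \<pi> i \<le> part_sum \<pi>"
  by (cases "\<pi> i = 0") (auto simp: partitions_def part_sum_def intro!: member_le_sum)

lemma part_eq_0_beyond_part_sum:
  assumes "\<pi> \<in> partitions" and "part_sum \<pi> \<le> i"
  shows "\<pi> i = 0"
proof (rule ccontr)
  assume "\<pi> i \<noteq> 0"
  then have sub: "{..i} \<subseteq> {i. \<pi> i \<noteq> 0}"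
    using partitionsD[OF assms(1)] by force
  have fin: "finite {i. \<pi> i \<noteq> 0}"
    using assms(1) by (simp add: partitions_def)
  have "card {..i} \<le> card {i. \<pi> i \<noteq> 0}"
    by (rule card_mono[OF fin sub])
  also have "\<dots> = (\<Sum>i | \<pi> i \<noteq> 0. 1)"
    by simp
  also have "\<dots> \<le> part_sum \<pi>"
    unfolding part_sum_def by (rule sum_mono) auto
  finally show False
    using assms(2) by simp
qed

lemma finite_partitions_of_size: "finite {\<pi> \<in> partitions. part_sum \<pi> = n}"
proof (rule finite_subset)
  show "{\<pi> \<in> partitions. part_sum \<pi> = n} \<subseteq>
      {\<pi>. \<forall>i. (i \<in> {..<n} \<longrightarrow> \<pi> i \<in> {..n}) \<and> (i \<notin> {..<n} \<longrightarrow> \<pi> i = 0)}"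
    using part_le_part_sum part_eq_0_beyond_part_sum by auto
qed (intro finite_set_of_finite_funs; simp)

text \<open>In the three formulas for the statistics below, \<open>N\<close> is any bound beyond the support.  This
  freedom allows a partition and a modification of it to be compared over the same range.\<close>

lemma sum_pairs:
  fixes f :: "nat \<Rightarrow> 'a :: comm_monoid_add"
  shows "sum f {..<2 * N} = (\<Sum>m<N. f (2 * m) + f (2 * m + 1))"
  by (induction N) (auto simp: add_ac)

lemma part_sum_eq_sum_pairs:
  assumes "\<pi> \<in> partitions" and "\<pi> (2 * N) = 0"
  shows "part_sum \<pi> = (\<Sum>m<N. \<pi> (2 * m) + \<pi> (2 * m + 1))"
proof -
  have "i < 2 * N" if "\<pi> i \<noteq> 0" for i
    using partitionsD[OF assms(1), of "2 * N" i] assms(2) that by (cases "2 * N \<le> i") auto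
  then have "part_sum \<pi> = sum \<pi> {..<2 * N}"
    unfolding part_sum_def by (intro sum.mono_neutral_left) auto
  then show ?thesis
    by (simp only: sum_pairs)
qed

lemma num_odd_parts_eq_sum_pairs:
  assumes "\<pi> \<in> partitions" and "\<pi> (2 * N) = 0"
  shows "num_odd_parts \<pi> = (\<Sum>m<N. \<pi> (2 * m) mod 2 + \<pi> (2 * m + 1) mod 2)"
proof -
  have "i < 2 * N" if "odd (\<pi> i)" for i
    using partitionsD[OF assms(1), of "2 * N" i] assms(2) that by (cases "2 * N \<le> i") auto
  then have "{i. odd (\<pi> i)} = {i \<in> {..<2 * N}. odd (\<pi> i)}"
    by auto
  then have "num_odd_parts \<pi> = (\<Sum>i<2 * N. if odd (\<pi> i) then 1 else 0)"
    by (simp add: num_odd_parts_def sum.If_cases Int_def)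
  also have "\<dots> = (\<Sum>i<2 * N. \<pi> i mod 2)"
    by (intro sum.cong refl) (simp add: mod2_eq_if)
  finally show ?thesis
    by (simp only: sum_pairs)
qed

lemma conjugate_eq_card:
  assumes "\<pi> \<in> partitions"
  shows "conjugate \<pi> i = card {k. i < \<pi> k}"
proof -
  let ?J = "{j. j \<ge> i + 1 \<and> part_mult \<pi> j \<noteq> 0}"
  have fin: "finite {k. \<pi> k = j}" if "j > 0" for j
    using assms that by (auto simp: partitions_def elim!: finite_subset[rotated])
  have "?J \<subseteq> {..\<pi> 0}"
  proof
    fix j assume "j \<in> ?J"
    then have "{k. \<pi> k = j} \<noteq> {}"
      unfolding part_mult_def by force
    then show "j \<in> {..\<pi> 0}"
      using partitionsD[OF assms, of 0] by auto
  qed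
  then have "finite ?J"
    by (rule finite_subset) simp
  then have "conjugate \<pi> i = card (\<Union>j\<in>?J. {k. \<pi> k = j})"
    unfolding conjugate_def part_mult_def
    by (subst card_UN_disjoint) (use fin in auto)
  also have "(\<Union>j\<in>?J. {k. \<pi> k = j}) = {k. i < \<pi> k}"
    using fin by (auto simp: part_mult_def card_eq_0_iff)
  finally show ?thesis .
qed

text \<open>Column \<open>i\<close> of the diagram has odd length \<open>2 m + 1\<close> exactly if it meets row \<open>2 m\<close> (rows being
  counted from 0) but not row \<open>2 m + 1\<close>.\<close>

lemma finite_down_closed_eq_lessThan:
  fixes A :: "nat set"
  assumes "finite A" and "\<And>k k'. k \<in> A \<Longrightarrow> k' \<le> k \<Longrightarrow> k' \<in> A"
  shows "\<exists>c. A = {..<c}"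
proof (cases "A = {}")
  case False
  then have "A = {..<Suc (Max A)}"
    using assms by (auto simp: less_Suc_eq_le intro: assms(2)[OF Max_in])
  then show ?thesis ..
qed (auto intro: exI[of _ 0])

lemma odd_conjugate_iff:
  assumes "\<pi> \<in> partitions"
  shows "odd (conjugate \<pi> i) \<longleftrightarrow> (\<exists>m. \<pi> (2 * m + 1) \<le> i \<and> i < \<pi> (2 * m))"
proof -
  have "finite {k. i < \<pi> k}"
    using assms by (auto simp: partitions_def elim!: finite_subset[rotated])
  moreover have "k' \<in> {k. i < \<pi> k}" if "k \<in> {k. i < \<pi> k}" "k' \<le> k" for k k'
    using partitionsD[OF assms that(2)] that(1) by simp
  ultimately have "\<exists>c. {k. i < \<pi> k} = {..<c}"
    by (rule finite_down_closed_eq_lessThan)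
  then obtain c where c: "{k. i < \<pi> k} = {..<c}" ..
  then have iff: "i < \<pi> k \<longleftrightarrow> k < c" for k
    by (metis lessThan_iff mem_Collect_eq)
  have "conjugate \<pi> i = c"
    using conjugate_eq_card[OF assms] c by simp
  moreover have "odd c \<longleftrightarrow> (\<exists>m. \<not> 2 * m + 1 < c \<and> 2 * m < c)"
    by presburger
  ultimately show ?thesis
    by (simp add: iff flip: not_less)
qed

lemma num_odd_parts_conjugate_eq_sum_pairs:
  assumes "\<pi> \<in> partitions" and "\<pi> (2 * N) = 0"
  shows "num_odd_parts (conjugate \<pi>) = (\<Sum>m<N. \<pi> (2 * m) - \<pi> (2 * m + 1))"
proof -
  have zero: "m < N" if "i < \<pi> (2 * m)" for i m
    using partitionsD[OF assms(1), of "2 * N" "2 * m"] that assms(2) by (cases "N \<le> m") auto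
  have "{i. odd (conjugate \<pi> i)} = (\<Union>m<N. {\<pi> (2 * m + 1)..<\<pi> (2 * m)})"
    using zero by (auto simp: odd_conjugate_iff[OF assms(1)]) (metis lessThan_iff)
  moreover have "{\<pi> (2 * m + 1)..<\<pi> (2 * m)} \<inter> {\<pi> (2 * m' + 1)..<\<pi> (2 * m')} = {}"
    if "m < m'" for m m'
    using partitionsD[OF assms(1), of "2 * m + 1" "2 * m'"] that by auto
  then have "{\<pi> (2 * m + 1)..<\<pi> (2 * m)} \<inter> {\<pi> (2 * m' + 1)..<\<pi> (2 * m')} = {}"
    if "m \<noteq> m'" for m m'
    using that by (metis Int_commute nat_neq_iff)
  ultimately show ?thesis
    by (simp add: num_odd_parts_def card_UN_disjoint)
qed

section \<open>Generating functions of sets of partitions\<close>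

text \<open>The size of the partition is recorded by the exponent of the formal variable, so the weight
  carries only the two numbers of odd parts.\<close>

definition weight :: "(nat \<Rightarrow> nat) \<Rightarrow> int poly poly" where
  "weight \<pi> = z_var ^ num_odd_parts \<pi> * y_var ^ num_odd_parts (conjugate \<pi>)"

definition gf :: "(nat \<Rightarrow> nat) set \<Rightarrow> int poly poly fps" where
  "gf A = Abs_fps (\<lambda>n. \<Sum>\<pi> | \<pi> \<in> A \<and> part_sum \<pi> = n. weight \<pi>)"

lemma gf_Un_disjoint:
  assumes "A \<subseteq> partitions" and "B \<subseteq> partitions" and "A \<inter> B = {}"
  shows "gf (A \<union> B) = gf A + gf B"
proof (rule fps_ext)
  fix n
  have "{\<pi>. \<pi> \<in> A \<union> B \<and> part_sum \<pi> = n} = {\<pi>. \<pi> \<in> A \<and> part_sum \<pi> = n} \<union> {\<pi>. \<pi> \<in> B \<and> part_sum \<pi> = n}"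
    by auto
  moreover have "finite {\<pi>. \<pi> \<in> A \<and> part_sum \<pi> = n}" "finite {\<pi>. \<pi> \<in> B \<and> part_sum \<pi> = n}"
    using assms by (auto intro!: finite_subset[OF _ finite_partitions_of_size[of n]])
  ultimately show "gf (A \<union> B) $ n = (gf A + gf B) $ n"
    using assms(3) by (simp add: gf_def sum.union_disjoint disjoint_iff)
qed

text \<open>Solves the recursions below, in which a set of partitions is split into a smaller set and
  a shifted copy of itself.\<close>

lemma eq_mult_one_minus:
  fixes c f g :: "'a :: comm_ring_1"
  assumes "f = g + c * f"
  shows "g = f * (1 - c)"
proof -
  have "g = f - c * f"
    by (subst (1) assms) simp
  then show ?thesis
    by (simp add: algebra_simps)
qed

lemma gf_image:
  assumes "inj_on \<phi> A"
    and "\<And>\<pi>. \<pi> \<in> A \<Longrightarrow> part_sum (\<phi> \<pi>) = part_sum \<pi> + d"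
    and "\<And>\<pi>. \<pi> \<in> A \<Longrightarrow> weight (\<phi> \<pi>) = c * weight \<pi>"
  shows "gf (\<phi> ` A) = fps_const c * fps_X ^ d * gf A"
proof (rule fps_ext)
  fix n
  show "gf (\<phi> ` A) $ n = (fps_const c * fps_X ^ d * gf A) $ n"
  proof (cases "n < d")
    case True
    then have empty: "{\<pi>. \<pi> \<in> \<phi> ` A \<and> part_sum \<pi> = n} = {}"
      using assms(2) by auto
    from True show ?thesis
      unfolding gf_def fps_nth_Abs_fps empty by (simp add: mult.assoc fps_X_power_mult_nth)
  next
    case False
    let ?A = "{\<pi>. \<pi> \<in> A \<and> part_sum \<pi> = n - d}"
    have "{\<pi>. \<pi> \<in> \<phi> ` A \<and> part_sum \<pi> = n} = \<phi> ` ?A"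
      using False assms(2) by auto
    moreover have "inj_on \<phi> ?A"
      using assms(1) by (rule inj_on_subset) auto
    ultimately have "gf (\<phi> ` A) $ n = (\<Sum>\<pi>\<in>?A. weight (\<phi> \<pi>))"
      unfolding gf_def fps_nth_Abs_fps by (simp only: sum.reindex o_def)
    also have "\<dots> = (\<Sum>\<pi>\<in>?A. c * weight \<pi>)"
      by (intro sum.cong refl) (simp add: assms(3))
    also have "\<dots> = c * gf A $ (n - d)"
      by (simp add: gf_def sum_distrib_left)
    finally show ?thesis
      using False by (simp add: mult.assoc fps_X_power_mult_nth)
  qed
qed

section \<open>Removing pairs of columns of equal odd length\<close>

text \<open>Rows are counted from 0, so the pairs consist of the rows \<open>2 i\<close> and \<open>2 i + 1\<close>, and the odd
  column lengths are the numbers \<open>2 i + 1\<close>.\<close>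

definition narrow_up_to :: "nat \<Rightarrow> (nat \<Rightarrow> nat) set" where
  "narrow_up_to K = {\<pi> \<in> partitions. \<forall>i<K. \<pi> (2 * i) \<le> \<pi> (2 * i + 1) + 1}"

definition add_two_columns :: "nat \<Rightarrow> (nat \<Rightarrow> nat) \<Rightarrow> nat \<Rightarrow> nat" where
  "add_two_columns l \<pi> i = (if i < l then \<pi> i + 2 else \<pi> i)"

lemma add_two_columns_in_partitions:
  assumes "\<pi> \<in> partitions"
  shows "add_two_columns l \<pi> \<in> partitions"
proof (rule partitionsI)
  show "add_two_columns l \<pi> (Suc i) \<le> add_two_columns l \<pi> i" for i
    using partitionsD[OF assms, of i "Suc i"] by (simp add: add_two_columns_def)
  show "add_two_columns l \<pi> i = 0" if "i \<ge> max l (part_sum \<pi>)" for i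
    using that part_eq_0_beyond_part_sum[OF assms] by (simp add: add_two_columns_def)
qed

text \<open>Only the difference of the pair numbered \<open>K\<close> changes, because this is the pair that the lower
  end of the two new columns separates; the other pairs are raised by 2 as a whole or not at all.\<close>

lemma add_two_columns_statistics:
  assumes "\<pi> \<in> partitions"
  shows "part_sum (add_two_columns (2 * K + 1) \<pi>) = part_sum \<pi> + (4 * K + 2)"
    and "weight (add_two_columns (2 * K + 1) \<pi>) = y_var ^ 2 * weight \<pi>"
proof -
  let ?\<phi> = "add_two_columns (2 * K + 1) \<pi>"
  have \<phi>: "?\<phi> \<in> partitions"
    using assms by (rule add_two_columns_in_partitions)
  obtain N where N: "K < N" and zero: "\<pi> (2 * N) = 0"
    using part_eq_0_beyond_part_sum[OF assms, of "2 * (Suc K + part_sum \<pi>)"]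
    by (intro that[of "Suc K + part_sum \<pi>"]) simp_all
  then have zero': "?\<phi> (2 * N) = 0"
    by (simp add: add_two_columns_def)
  have "(\<Sum>m<N. if m < K then 4 else 0) = card {..<K} * (4::nat)"
  proof -
    have "{..<N} \<inter> {m. m < K} = {..<K}"
      using N by auto
    then show ?thesis
      by (simp only: sum.If_cases[OF finite_lessThan]) simp
  qed
  moreover have "?\<phi> (2 * m) + ?\<phi> (2 * m + 1) =
      \<pi> (2 * m) + \<pi> (2 * m + 1) + ((if m < K then 4 else 0) + (if m = K then 2 else 0))" for m
    by (auto simp: add_two_columns_def)
  ultimately show "part_sum ?\<phi> = part_sum \<pi> + (4 * K + 2)"
    unfolding part_sum_eq_sum_pairs[OF \<phi> zero'] part_sum_eq_sum_pairs[OF assms zero]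
    using N by (simp add: sum.distrib)
  have "num_odd_parts ?\<phi> = num_odd_parts \<pi>"
    unfolding num_odd_parts_eq_sum_pairs[OF \<phi> zero'] num_odd_parts_eq_sum_pairs[OF assms zero]
    by (intro sum.cong refl) (simp add: add_two_columns_def)
  moreover have "num_odd_parts (conjugate ?\<phi>) = num_odd_parts (conjugate \<pi>) + 2"
  proof -
    have "?\<phi> (2 * m) - ?\<phi> (2 * m + 1) = \<pi> (2 * m) - \<pi> (2 * m + 1) + (if m = K then 2 else 0)" for m
      using partitionsD[OF assms, of "2 * m" "2 * m + 1"] by (auto simp: add_two_columns_def)
    then show ?thesis
      unfolding num_odd_parts_conjugate_eq_sum_pairs[OF \<phi> zero']
        num_odd_parts_conjugate_eq_sum_pairs[OF assms zero]
      using N by (simp add: sum.distrib)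
  qed
  ultimately show "weight ?\<phi> = y_var ^ 2 * weight \<pi>"
    by (simp only: weight_def power_add mult_ac)
qed

text \<open>If the difference of the pair numbered \<open>K\<close> exceeds 1, there are two columns of length
  \<open>2 K + 1\<close> to remove, and the differences of the earlier pairs do not notice the removal.\<close>

lemma narrow_up_to_eq:
  "narrow_up_to K = narrow_up_to (Suc K) \<union> add_two_columns (2 * K + 1) ` narrow_up_to K"
proof (intro equalityI subsetI)
  fix \<pi> assume \<pi>: "\<pi> \<in> narrow_up_to K"
  show "\<pi> \<in> narrow_up_to (Suc K) \<union> add_two_columns (2 * K + 1) ` narrow_up_to K"
  proof (cases "\<pi> (2 * K) \<le> \<pi> (2 * K + 1) + 1")
    case True
    with \<pi> show ?thesis
      by (auto simp: narrow_up_to_def less_Suc_eq)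
  next
    case False
    have part: "\<pi> \<in> partitions"
      using \<pi> by (simp add: narrow_up_to_def)
    have big: "\<pi> i \<ge> \<pi> (2 * K + 1) + 2" if "i < 2 * K + 1" for i
      using partitionsD[OF part, of i "2 * K"] that False by simp
    define \<rho> where "\<rho> i = (if i < 2 * K + 1 then \<pi> i - 2 else \<pi> i)" for i
    have "\<rho> \<in> partitions"
    proof (rule partitionsI)
      show "\<rho> (Suc i) \<le> \<rho> i" for i
      proof (cases "i = 2 * K")
        case True
        then show ?thesis
          using big[of i] by (simp add: \<rho>_def)
      next
        case False
        then show ?thesis
          using partitionsD[OF part, of i "Suc i"] by (auto simp: \<rho>_def)
      qed
      show "\<rho> i = 0" if "i \<ge> part_sum \<pi>" for i
        using part_eq_0_beyond_part_sum[OF part that] by (simp add: \<rho>_def)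
    qed
    then have "\<rho> \<in> narrow_up_to K"
      using \<pi> by (force simp: narrow_up_to_def \<rho>_def)
    moreover have "\<pi> = add_two_columns (2 * K + 1) \<rho>"
      using big by (force simp: add_two_columns_def \<rho>_def fun_eq_iff)
    ultimately show ?thesis
      by blast
  qed
next
  fix \<pi> assume "\<pi> \<in> narrow_up_to (Suc K) \<union> add_two_columns (2 * K + 1) ` narrow_up_to K"
  then show "\<pi> \<in> narrow_up_to K"
  proof
    assume "\<pi> \<in> narrow_up_to (Suc K)"
    then show ?thesis
      by (auto simp: narrow_up_to_def)
  next
    assume "\<pi> \<in> add_two_columns (2 * K + 1) ` narrow_up_to K"
    then obtain \<rho> where "\<rho> \<in> narrow_up_to K" "\<pi> = add_two_columns (2 * K + 1) \<rho>"
      by blast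
    then show ?thesis
      using add_two_columns_in_partitions[of \<rho>] by (auto simp: narrow_up_to_def add_two_columns_def)
  qed
qed

lemma gf_narrow_up_to_Suc:
  "gf (narrow_up_to (Suc K)) = gf (narrow_up_to K) * (1 - fps_const (y_var ^ 2) * fps_X ^ (4 * K + 2))"
proof -
  let ?\<phi> = "add_two_columns (2 * K + 1)"
  have sub: "narrow_up_to j \<subseteq> partitions" for j
    by (auto simp: narrow_up_to_def)
  have "narrow_up_to (Suc K) \<inter> ?\<phi> ` narrow_up_to K = {}"
  proof -
    have "?\<phi> \<pi> \<notin> narrow_up_to (Suc K)" if "\<pi> \<in> narrow_up_to K" for \<pi>
      using partitionsD[of \<pi> "2 * K" "2 * K + 1"] that
      by (auto simp: narrow_up_to_def add_two_columns_def)
    then show ?thesis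
      by blast
  qed
  moreover have "?\<phi> ` narrow_up_to K \<subseteq> partitions"
    using sub add_two_columns_in_partitions by blast
  ultimately have "gf (narrow_up_to K) = gf (narrow_up_to (Suc K)) + gf (?\<phi> ` narrow_up_to K)"
    using gf_Un_disjoint[OF sub] narrow_up_to_eq by metis
  moreover have "inj_on ?\<phi> (narrow_up_to K)"
    by (rule inj_onI) (metis (no_types, lifting) add_two_columns_def add_right_imp_eq ext)
  then have "gf (?\<phi> ` narrow_up_to K) =
      fps_const (y_var ^ 2) * fps_X ^ (4 * K + 2) * gf (narrow_up_to K)"
    by (rule gf_image) (erule add_two_columns_statistics[OF subsetD[OF sub]])+
  ultimately show ?thesis
    by (intro eq_mult_one_minus) simp
qed

lemma gf_narrow_up_to:
  "gf (narrow_up_to K) =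
     gf partitions * (\<Prod>j<K. 1 - fps_const (y_var ^ 2) * fps_X ^ (4 * j + 2))"
proof (induction K)
  case 0
  then show ?case
    by (simp add: narrow_up_to_def)
next
  case (Suc K)
  show ?case
    unfolding gf_narrow_up_to_Suc Suc.IH prod.lessThan_Suc by (rule mult.assoc)
qed

section \<open>Narrow partitions as partitions with distinct odd parts\<close>

definition narrow :: "(nat \<Rightarrow> nat) set" where
  "narrow = {\<pi> \<in> partitions. \<forall>i. \<pi> (2 * i) \<le> \<pi> (2 * i + 1) + 1}"

text \<open>In terms of the partition \<open>t\<close> of pair sums, these are the narrow partitions for which all
  parts of \<open>t\<close> are at most \<open>M\<close>.\<close>

definition narrow_le :: "nat \<Rightarrow> (nat \<Rightarrow> nat) set" where
  "narrow_le M = {\<pi> \<in> narrow. \<pi> 0 + \<pi> 1 \<le> M}"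

definition push_pair :: "nat \<Rightarrow> nat \<Rightarrow> (nat \<Rightarrow> nat) \<Rightarrow> nat \<Rightarrow> nat" where
  "push_pair a b \<pi> = case_nat a (case_nat b \<pi>)"

lemma push_pair_simps [simp]:
  "push_pair a b \<pi> 0 = a"
  "push_pair a b \<pi> (Suc 0) = b"
  "push_pair a b \<pi> (Suc (Suc i)) = \<pi> i"
  by (simp_all add: push_pair_def)

lemma push_pair_in_partitions:
  assumes "\<pi> \<in> partitions" and "\<pi> 0 \<le> b" and "b \<le> a"
  shows "push_pair a b \<pi> \<in> partitions"
proof (rule partitionsI)
  show "push_pair a b \<pi> (Suc i) \<le> push_pair a b \<pi> i" for i
  proof (cases i)
    case 0
    then show ?thesis
      using assms(3) by simp
  next
    case (Suc k)
    then show ?thesis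
      using assms(2) partitionsD[OF assms(1), of "k - 1" k] by (cases k) simp_all
  qed
  show "push_pair a b \<pi> i = 0" if "i \<ge> part_sum \<pi> + 2" for i
    using that part_eq_0_beyond_part_sum[OF assms(1), of "i - 2"]
    by (auto simp: push_pair_def split: nat.splits)
qed

lemma push_pair_statistics:
  assumes "\<pi> \<in> partitions" and "\<pi> 0 \<le> b" and "b \<le> a"
  shows "part_sum (push_pair a b \<pi>) = part_sum \<pi> + (a + b)"
    and "weight (push_pair a b \<pi>) = z_var ^ (a mod 2 + b mod 2) * y_var ^ (a - b) * weight \<pi>"
proof -
  let ?\<phi> = "push_pair a b \<pi>"
  have \<phi>: "?\<phi> \<in> partitions"
    using assms by (rule push_pair_in_partitions)
  obtain N where zero: "\<pi> (2 * N) = 0"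
    using part_eq_0_beyond_part_sum[OF assms(1), of "2 * part_sum \<pi>"] by force
  then have zero': "?\<phi> (2 * Suc N) = 0"
    by simp
  note shift = sum.lessThan_Suc_shift
  show "part_sum ?\<phi> = part_sum \<pi> + (a + b)"
    unfolding part_sum_eq_sum_pairs[OF \<phi> zero'] part_sum_eq_sum_pairs[OF assms(1) zero]
    by (subst shift) simp
  have "num_odd_parts ?\<phi> = a mod 2 + b mod 2 + num_odd_parts \<pi>"
    unfolding num_odd_parts_eq_sum_pairs[OF \<phi> zero'] num_odd_parts_eq_sum_pairs[OF assms(1) zero]
    by (subst shift) simp
  moreover have "num_odd_parts (conjugate ?\<phi>) = a - b + num_odd_parts (conjugate \<pi>)"
    unfolding num_odd_parts_conjugate_eq_sum_pairs[OF \<phi> zero']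
      num_odd_parts_conjugate_eq_sum_pairs[OF assms(1) zero]
    by (subst shift) simp
  ultimately show "weight ?\<phi> = z_var ^ (a mod 2 + b mod 2) * y_var ^ (a - b) * weight \<pi>"
    by (simp add: weight_def power_add mult_ac)
qed

lemma narrow_le_subset_partitions: "narrow_le M \<subseteq> partitions"
  by (auto simp: narrow_le_def narrow_def)

lemma narrow_first_pair: "\<pi> \<in> narrow \<Longrightarrow> \<pi> 1 \<le> \<pi> 0 \<and> \<pi> 0 \<le> \<pi> 1 + 1"
  using partitionsD[of \<pi> 0 1] by (force simp: narrow_def dest: spec[where x = 0])

lemma narrow_le_even_iff: "\<pi> \<in> narrow_le (2 * a) \<longleftrightarrow> \<pi> \<in> narrow \<and> \<pi> 0 \<le> a"
  using narrow_first_pair[of \<pi>] by (auto simp: narrow_le_def)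

lemma push_pair_in_narrow:
  assumes "\<pi> \<in> narrow" and "\<pi> 0 \<le> b" and "b \<le> a" and "a \<le> b + 1"
  shows "push_pair a b \<pi> \<in> narrow"
proof -
  have "push_pair a b \<pi> (2 * i) \<le> push_pair a b \<pi> (2 * i + 1) + 1" for i
    using assms(1,4) by (cases i) (simp_all add: narrow_def)
  moreover have "push_pair a b \<pi> \<in> partitions"
    using assms by (intro push_pair_in_partitions) (simp_all add: narrow_def)
  ultimately show ?thesis
    by (simp add: narrow_def)
qed

lemma narrow_eq_push_pair:
  assumes "\<pi> \<in> narrow"
  obtains \<rho> where "\<rho> \<in> narrow" "\<rho> 0 \<le> \<pi> 1" "\<pi> = push_pair (\<pi> 0) (\<pi> 1) \<rho>"
proof
  let ?\<rho> = "\<lambda>i. \<pi> (i + 2)"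
  have part: "\<pi> \<in> partitions"
    using assms by (simp add: narrow_def)
  have "?\<rho> \<in> partitions"
    by (rule partitionsI[where N = "part_sum \<pi>"])
      (use partitionsD[OF part] part_eq_0_beyond_part_sum[OF part] in auto)
  moreover have "?\<rho> (2 * i) \<le> ?\<rho> (2 * i + 1) + 1" for i
    using assms by (auto simp: narrow_def dest: spec[where x = "Suc i"])
  ultimately show "?\<rho> \<in> narrow"
    by (simp add: narrow_def)
  show "?\<rho> 0 \<le> \<pi> 1"
    using partitionsD[OF part] by simp
  show "\<pi> = push_pair (\<pi> 0) (\<pi> 1) ?\<rho>"
  proof
    fix i
    show "\<pi> i = push_pair (\<pi> 0) (\<pi> 1) ?\<rho> i"
      by (cases i; cases "i - 1") simp_all
  qed
qed

text \<open>What remains below a first pair with smaller entry \<open>b\<close> has pair sums at most \<open>2 b\<close>.  For the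
  pair \<open>(b, b)\<close> this bound equals the removed sum, so the sum can occur again; for \<open>(b + 1, b)\<close> it
  is less by 1, which is why odd sums are distinct.\<close>

lemma narrow_with_first_pair_eq:
  assumes "b \<le> a" and "a \<le> b + 1"
  shows "{\<pi> \<in> narrow. \<pi> 0 = a \<and> \<pi> 1 = b} = push_pair a b ` narrow_le (2 * b)"
proof (intro equalityI subsetI)
  fix \<pi> assume \<pi>: "\<pi> \<in> {\<pi> \<in> narrow. \<pi> 0 = a \<and> \<pi> 1 = b}"
  then obtain \<rho> where "\<rho> \<in> narrow" "\<rho> 0 \<le> \<pi> 1" "\<pi> = push_pair (\<pi> 0) (\<pi> 1) \<rho>"
    by (blast elim: narrow_eq_push_pair)
  with \<pi> have "\<rho> \<in> narrow_le (2 * b)" "\<pi> = push_pair a b \<rho>"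
    by (simp_all add: narrow_le_even_iff)
  then show "\<pi> \<in> push_pair a b ` narrow_le (2 * b)"
    by blast
next
  fix \<pi> assume "\<pi> \<in> push_pair a b ` narrow_le (2 * b)"
  then show "\<pi> \<in> {\<pi> \<in> narrow. \<pi> 0 = a \<and> \<pi> 1 = b}"
    using assms by (auto simp: narrow_le_even_iff intro!: push_pair_in_narrow)
qed

lemma gf_first_pair:
  assumes "b \<le> a" and "a \<le> b + 1"
  shows "gf {\<pi> \<in> narrow. \<pi> 0 = a \<and> \<pi> 1 = b} =
    fps_const (z_var ^ (a mod 2 + b mod 2) * y_var ^ (a - b)) * fps_X ^ (a + b) * gf (narrow_le (2 * b))"
  unfolding narrow_with_first_pair_eq[OF assms]
proof (rule gf_image)
  show "inj_on (push_pair a b) (narrow_le (2 * b))"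
    by (rule inj_onI) (metis ext push_pair_simps(3))
  fix \<pi> assume "\<pi> \<in> narrow_le (2 * b)"
  then have "\<pi> \<in> partitions" "\<pi> 0 \<le> b"
    by (simp_all add: narrow_le_even_iff) (simp add: narrow_def)
  from push_pair_statistics[OF this assms(1)]
  show "part_sum (push_pair a b \<pi>) = part_sum \<pi> + (a + b)"
    and "weight (push_pair a b \<pi>) = z_var ^ (a mod 2 + b mod 2) * y_var ^ (a - b) * weight \<pi>" .
qed

lemma gf_narrow_le_Suc:
  assumes "b \<le> a" and "a \<le> b + 1" and "Suc M = a + b"
  shows "gf (narrow_le (Suc M)) = gf (narrow_le M) +
    fps_const (z_var ^ (a mod 2 + b mod 2) * y_var ^ (a - b)) * fps_X ^ (a + b) * gf (narrow_le (2 * b))"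
proof -
  have "\<pi> 0 = a \<and> \<pi> 1 = b" if "\<pi> \<in> narrow" "\<pi> 0 + \<pi> 1 = a + b" for \<pi>
    using narrow_first_pair[OF that(1)] that(2) assms by linarith
  then have "narrow_le (Suc M) = narrow_le M \<union> {\<pi> \<in> narrow. \<pi> 0 = a \<and> \<pi> 1 = b}"
    using assms(3) by (auto simp: narrow_le_def le_Suc_eq)
  moreover have "narrow_le M \<inter> {\<pi> \<in> narrow. \<pi> 0 = a \<and> \<pi> 1 = b} = {}"
    using assms(3) by (auto simp: narrow_le_def)
  moreover have "{\<pi> \<in> narrow. \<pi> 0 = a \<and> \<pi> 1 = b} \<subseteq> partitions"
    by (auto simp: narrow_def)
  ultimately show ?thesis
    using gf_Un_disjoint[OF narrow_le_subset_partitions] gf_first_pair[OF assms(1,2)] by simp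
qed

lemma gf_narrow_le_0: "gf (narrow_le 0) = 1"
proof -
  have eq: "narrow_le 0 = {\<lambda>_. 0}"
  proof (intro equalityI subsetI)
    fix \<pi> assume "\<pi> \<in> narrow_le 0"
    then have "\<pi> \<in> partitions" "\<pi> 0 = 0"
      by (auto simp: narrow_le_def narrow_def)
    then show "\<pi> \<in> {\<lambda>_. 0}"
      using partitionsD[of \<pi> 0] by force
  qed (auto simp: narrow_le_def narrow_def partitions_def antimono_def)
  then have part: "(\<lambda>_. 0) \<in> partitions"
    using narrow_le_subset_partitions by blast
  have wt: "weight (\<lambda>_. 0) = 1"
    using num_odd_parts_eq_sum_pairs[OF part, of 0]
      num_odd_parts_conjugate_eq_sum_pairs[OF part, of 0] by (simp add: weight_def)
  have size: "part_sum (\<lambda>_. 0) = 0"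
    by (simp add: part_sum_def)
  show ?thesis
  proof (rule fps_ext)
    fix n
    have "{\<pi>. \<pi> \<in> narrow_le 0 \<and> part_sum \<pi> = n} = (if n = 0 then {\<lambda>_. 0} else {})"
      using size by (auto simp: eq)
    then show "gf (narrow_le 0) $ n = 1 $ n"
      unfolding gf_def fps_nth_Abs_fps by (simp add: wt)
  qed
qed

text \<open>The sum \<open>2 a + 2\<close> comes from the pair \<open>(a + 1, a + 1)\<close>, which contains two odd parts or none
  according to the parity of \<open>a + 1\<close>; hence the exponent of \<open>z\<close>.\<close>

lemma gf_narrow_le_even:
  "gf (narrow_le (2 * n)) * (\<Prod>a<n. 1 - fps_const (z_var ^ (2 * (Suc a mod 2))) * fps_X ^ (2 * a + 2)) =
     (\<Prod>a<n. 1 + fps_const (y_var * z_var) * fps_X ^ (2 * a + 1))"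
proof (induction n)
  case 0
  then show ?case
    by (simp add: gf_narrow_le_0)
next
  case (Suc n)
  have "Suc n mod 2 + n mod 2 = 1"
    by presburger
  then have odd_step: "gf (narrow_le (Suc (2 * n))) =
      gf (narrow_le (2 * n)) * (1 + fps_const (y_var * z_var) * fps_X ^ (2 * n + 1))"
    using gf_narrow_le_Suc[of n "Suc n" "2 * n"] by (simp add: algebra_simps)
  have eqs: "Suc (Suc (2 * n)) = 2 * Suc n" "Suc n + Suc n = 2 * n + 2"
      "Suc n mod 2 + Suc n mod 2 = 2 * (Suc n mod 2)"
    by simp_all
  have "Suc (Suc (2 * n)) = Suc n + Suc n"
    by simp
  note gf_narrow_le_Suc[OF order_refl le_add1 this, unfolded eqs diff_self_eq_0 power_0 mult_1_right]
  then have even_step: "gf (narrow_le (2 * Suc n)) *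
      (1 - fps_const (z_var ^ (2 * (Suc n mod 2))) * fps_X ^ (2 * n + 2)) = gf (narrow_le (Suc (2 * n)))"
    by (rule eq_mult_one_minus[symmetric])
  have rearrange: "g' * (p * w) = g * p * e" if "g' * w = g * e"
    for e g g' p w :: "int poly poly fps"
    using that by (simp only: mult.left_commute[of g'] mult.assoc mult.left_commute[of p])
  show ?case
    unfolding prod.lessThan_Suc Suc.IH[symmetric]
    by (rule rearrange) (rule even_step[unfolded odd_step])
qed

section \<open>Truncation and passage to the limit\<close>

lemma fps_X_power_dvd_iff:
  fixes f :: "'a :: comm_ring_1 fps"
  shows "fps_X ^ n dvd f \<longleftrightarrow> (\<forall>k<n. f $ k = 0)"
proof
  assume "fps_X ^ n dvd f"
  then show "\<forall>k<n. f $ k = 0"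
    by (auto simp: dvd_def fps_X_power_mult_nth)
next
  assume "\<forall>k<n. f $ k = 0"
  then have "f = fps_X ^ n * fps_shift n f"
    by (intro fps_ext) (simp add: fps_X_power_mult_nth)
  then show "fps_X ^ n dvd f"
    by (rule dvdI)
qed

text \<open>A partition of \<open>k < N\<close> vanishes from row \<open>2 N\<close> on, so that being narrow concerns only the first
  \<open>N\<close> pairs, and its first pair has sum at most \<open>2 k\<close>.\<close>

lemma narrow_gfs_agree: "fps_X ^ N dvd gf (narrow_up_to N) - gf (narrow_le (4 * N))"
  unfolding fps_X_power_dvd_iff
proof (intro allI impI)
  fix k assume "k < N"
  have "\<pi> \<in> narrow_up_to N \<longleftrightarrow> \<pi> \<in> narrow_le (4 * N)" if k: "part_sum \<pi> = k" for \<pi>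
  proof (cases "\<pi> \<in> partitions")
    case True
    have "\<pi> (2 * i) = 0" if "i \<ge> N" for i
      using part_eq_0_beyond_part_sum[OF True] that k \<open>k < N\<close> by simp
    then have "\<pi> \<in> narrow_up_to N \<longleftrightarrow> \<pi> \<in> narrow"
      using True by (auto simp: narrow_up_to_def narrow_def) (metis le0 not_less)
    moreover have "\<pi> 0 + \<pi> 1 \<le> 4 * N"
      using part_le_part_sum[OF True, of 0] part_le_part_sum[OF True, of 1] k \<open>k < N\<close> by simp
    ultimately show ?thesis
      by (simp add: narrow_le_def)
  qed (auto simp: narrow_up_to_def narrow_le_def narrow_def)
  then have "{\<pi>. \<pi> \<in> narrow_up_to N \<and> part_sum \<pi> = k} = {\<pi>. \<pi> \<in> narrow_le (4 * N) \<and> part_sum \<pi> = k}"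
    by auto
  then show "(gf (narrow_up_to N) - gf (narrow_le (4 * N))) $ k = 0"
    by (simp add: gf_def)
qed

lemma dvd_prod_diff_1:
  fixes f :: "'a \<Rightarrow> 'b :: comm_ring_1"
  assumes "\<And>i. i \<in> A \<Longrightarrow> d dvd f i - 1"
  shows "d dvd prod f A - 1"
  using assms
proof (induction A rule: infinite_finite_induct)
  case (insert i A)
  have "prod f (insert i A) - 1 = (f i - 1) * prod f A + (prod f A - 1)"
    using insert.hyps by (simp add: algebra_simps)
  moreover have "d dvd (f i - 1) * prod f A" "d dvd prod f A - 1"
    using insert by simp_all
  ultimately show ?case
    by (simp only: dvd_add)
qed auto

text \<open>The first \<open>N\<close> denominators involve the even pair sums up to \<open>4 N\<close>, but the first \<open>N\<close>
  numerators only the odd sums below \<open>2 N\<close>.  The missing numerators are congruent to 1 modulo \<open>q\<^sup>N\<close>.\<close>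

lemma prod_gf_factor_agrees: "fps_X ^ N dvd gf partitions - (\<Prod>j<N. gf_factor (j + 1))"
proof -
  let ?E = "\<lambda>a. 1 + fps_const (y_var * z_var) * fps_X ^ (2 * a + 1)"
  let ?y = "\<lambda>j. 1 - fps_const (y_var ^ 2) * fps_X ^ (4 * j + 2)"
  let ?w = "\<lambda>a. 1 - fps_const (z_var ^ (2 * (Suc a mod 2))) * fps_X ^ (2 * a + 2)"
  let ?D = "\<lambda>j. (1 - fps_X ^ (4 * (j + 1))) *
        (1 - fps_const (z_var ^ 2) * fps_X ^ (4 * (j + 1) - 2)) *
        (1 - fps_const (y_var ^ 2) * fps_X ^ (4 * (j + 1) - 2))"
  let ?I = "\<lambda>j. fps_right_inverse (?D j) 1"
  have factor: "gf_factor (j + 1) = ?E j * ?I j" for j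
    by (simp add: gf_factor_def)
  have inv: "?D j * ?I j = 1" for j
    by (rule fps_right_inverse) (simp add: fps_X_power_nth)
  \<comment> \<open>The factors with \<open>q\<^bsup>4j\<^esup>\<close> and with \<open>z\<^sup>2 q\<^bsup>4j-2\<^esup>\<close> are the even pair sums of the two residues modulo 4.\<close>
  have D_split: "?D j = ?w (2 * j + 1) * ?w (2 * j) * ?y j" for j
  proof -
    have eqs: "Suc (2 * j + 1) mod 2 = 0" "Suc (2 * j) mod 2 = 1"
        "2 * (2 * j + 1) + 2 = 4 * (j + 1)" "2 * (2 * j) + 2 = 4 * j + 2" "4 * (j + 1) - 2 = 4 * j + 2"
      by simp_all
    show ?thesis
      unfolding eqs by simp
  qed
  have D: "prod ?D {..<K} = prod ?w {..<2 * K} * prod ?y {..<K}" for K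
  proof (induction K)
    case (Suc K)
    have "prod ?w {..<2 * Suc K} = prod ?w {..<2 * K} * ?w (2 * K) * ?w (2 * K + 1)"
      by simp
    then show ?case
      unfolding prod.lessThan_Suc D_split Suc.IH[unfolded D_split] by (simp only: mult_ac)
  qed simp
  have split: "prod ?E {..<2 * N} = prod ?E {..<N} * prod ?E {N..<2 * N}"
    by (subst prod.union_disjoint[symmetric]) (auto intro!: prod.cong)
  have "fps_X ^ N dvd ?E a - 1" if "a \<in> {N..<2 * N}" for a
    using that by (auto intro!: dvd_mult le_imp_power_dvd)
  then have "fps_X ^ N dvd prod ?E {N..<2 * N} - 1"
    by (rule dvd_prod_diff_1)
  then have "fps_X ^ N dvd prod ?E {..<N} * (prod ?E {N..<2 * N} - 1)"
    by (rule dvd_mult)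
  then have E: "fps_X ^ N dvd prod ?E {..<2 * N} - prod ?E {..<N}"
    unfolding split right_diff_distrib mult_1_right .
  have "fps_X ^ N dvd gf partitions * prod ?D {..<N} - prod ?E {..<2 * N}"
  proof -
    have "2 * (2 * N) = 4 * N"
      by simp
    note gf_narrow_le_even[of "2 * N", unfolded this]
    then have "gf partitions * prod ?D {..<N} - prod ?E {..<2 * N} =
        (gf (narrow_up_to N) - gf (narrow_le (4 * N))) * prod ?w {..<2 * N}"
      unfolding D gf_narrow_up_to unfolding left_diff_distrib by (simp only: mult_ac)
    then show ?thesis
      using narrow_gfs_agree by simp
  qed
  from dvd_add[OF this E] have "fps_X ^ N dvd gf partitions * prod ?D {..<N} - prod ?E {..<N}"
    unfolding add_diff_eq diff_add_cancel .
  then have dvd: "fps_X ^ N dvd (gf partitions * prod ?D {..<N} - prod ?E {..<N}) * prod ?I {..<N}"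
    by (rule dvd_mult2)
  have cancel: "(f * d - e) * i = f - e * i" if "d * i = 1"
    for d e f i :: "int poly poly fps"
    using that by (simp add: left_diff_distrib mult.assoc)
  have "prod ?D {..<N} * prod ?I {..<N} = 1"
    unfolding prod.distrib[symmetric] inv by simp
  from dvd[unfolded cancel[OF this]] show ?thesis
    unfolding factor prod.distrib .
qed

lemma has_prod_gf_factor: "(\<lambda>j. gf_factor (j + 1)) has_prod gf partitions"
proof -
  have agree: "(\<Prod>j<N. gf_factor (j + 1)) $ n = gf partitions $ n" if "n < N" for N n
    using prod_gf_factor_agrees[of N] that by (simp add: fps_X_power_dvd_iff)
  have "(\<lambda>N. \<Prod>j\<le>N. gf_factor (j + 1)) \<longlonglongrightarrow> gf partitions"
  proof (rule tendsto_fpsI)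
    fix n
    show "eventually (\<lambda>N. (\<Prod>j\<le>N. gf_factor (j + 1)) $ n = gf partitions $ n) sequentially"
      using eventually_ge_at_top[of n]
      by eventually_elim (use agree[of n "Suc _"] in \<open>simp add: lessThan_Suc_atMost\<close>)
  qed
  moreover have "gf partitions $ 0 = 1"
    using agree[of 0 1] by (simp add: gf_factor_def)
  then have "gf partitions \<noteq> 0"
    by auto
  ultimately show ?thesis
    by (simp add: has_prod_def raw_has_prod_def)
qed

lemma num_odd_parts_le_part_sum:
  assumes "\<pi> \<in> partitions"
  shows "num_odd_parts \<pi> \<le> part_sum \<pi>" and "num_odd_parts (conjugate \<pi>) \<le> part_sum \<pi>"
proof -
  obtain N where zero: "\<pi> (2 * N) = 0"
    using part_eq_0_beyond_part_sum[OF assms, of "2 * part_sum \<pi>"] by force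
  show "num_odd_parts \<pi> \<le> part_sum \<pi>"
    unfolding num_odd_parts_eq_sum_pairs[OF assms zero] part_sum_eq_sum_pairs[OF assms zero]
    by (intro sum_mono add_mono mod_less_eq_dividend)
  show "num_odd_parts (conjugate \<pi>) \<le> part_sum \<pi>"
    unfolding num_odd_parts_conjugate_eq_sum_pairs[OF assms zero] part_sum_eq_sum_pairs[OF assms zero]
    by (rule sum_mono) simp
qed

lemma gf_partitions_nth:
  "gf partitions $ n = (\<Sum>(r, s)\<in>{..n} \<times> {..n}. of_nat (S r s n) * z_var ^ r * y_var ^ s)"
proof -
  let ?P = "{\<pi> \<in> partitions. part_sum \<pi> = n}"
  let ?h = "\<lambda>\<pi>. (num_odd_parts \<pi>, num_odd_parts (conjugate \<pi>))"
  have "gf partitions $ n = sum weight ?P"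
    by (simp add: gf_def)
  also have "\<dots> = (\<Sum>p\<in>{..n} \<times> {..n}. sum weight {\<pi> \<in> ?P. ?h \<pi> = p})"
    by (rule sum.group[symmetric])
      (use num_odd_parts_le_part_sum in \<open>auto intro: finite_partitions_of_size\<close>)
  also have "\<dots> = (\<Sum>(r, s)\<in>{..n} \<times> {..n}. of_nat (S r s n) * z_var ^ r * y_var ^ s)"
  proof (intro sum.cong refl, clarify)
    fix r s
    have "sum weight {\<pi> \<in> ?P. ?h \<pi> = (r, s)} = (\<Sum>\<pi> | \<pi> \<in> ?P \<and> ?h \<pi> = (r, s). z_var ^ r * y_var ^ s)"
      by (intro sum.cong) (auto simp: weight_def)
    moreover have "{\<pi> \<in> ?P. ?h \<pi> = (r, s)} =
        {\<pi>. partition_of \<pi> n \<and> num_odd_parts \<pi> = r \<and> num_odd_parts (conjugate \<pi>) = s}"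
      by (auto simp: partition_of_iff)
    ultimately show "sum weight {\<pi> \<in> ?P. ?h \<pi> = (r, s)} = of_nat (S r s n) * z_var ^ r * y_var ^ s"
      by (simp add: S_def mult.assoc)
  qed
  finally show ?thesis .
qed

lemma S_eq_0:
  assumes "\<not> (r \<le> n \<and> s \<le> n)"
  shows "S r s n = 0"
proof -
  have "{\<pi>. partition_of \<pi> n \<and> num_odd_parts \<pi> = r \<and> num_odd_parts (conjugate \<pi>) = s} = {}"
    using assms num_odd_parts_le_part_sum by (auto simp: partition_of_iff)
  then show ?thesis
    by (simp only: S_def card.empty)
qed

lemma has_sum_gf_term: "((\<lambda>(n, r, s). gf_term n r s) has_sum gf partitions) UNIV"
  unfolding has_sum_def
proof (rule tendsto_fpsI)
  fix k :: nat
  let ?B = "{k} \<times> {..k} \<times> {..k}"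
  let ?f = "\<lambda>(n, r, s). gf_term n r s"
  have zero: "?f x $ k = 0" if "x \<notin> ?B" for x
  proof -
    obtain n r s where x: "x = (n, r, s)"
      by (cases x)
    show ?thesis
    proof (cases "n = k")
      case True
      with that x have "S r s n = 0"
        by (intro S_eq_0) auto
      then show ?thesis
        by (simp add: x gf_term_def)
    next
      case False
      then show ?thesis
        by (simp add: x gf_term_def fps_X_power_mult_right_nth)
    qed
  qed
  have "sum ?f Y $ k = gf partitions $ k" if "finite Y" "?B \<subseteq> Y" for Y
  proof -
    have "sum ?f Y $ k = (\<Sum>x\<in>Y. ?f x $ k)"
      by (rule fps_sum_nth)
    also have "\<dots> = (\<Sum>x\<in>?B. ?f x $ k)"
      using that zero by (intro sum.mono_neutral_right) auto
    also have "\<dots> = (\<Sum>(r, s)\<in>{..k} \<times> {..k}. gf_term k r s $ k)"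
      by (rule sum.reindex_bij_witness[of _ "Pair k" snd]) auto
    also have "\<dots> = gf partitions $ k"
      unfolding gf_partitions_nth
      by (intro sum.cong) (auto simp: gf_term_def fps_X_power_mult_right_nth)
    finally show ?thesis .
  qed
  then show "eventually (\<lambda>Y. sum ?f Y $ k = gf partitions $ k) (finite_subsets_at_top UNIV)"
    unfolding eventually_finite_subsets_at_top by (intro exI[of _ ?B]) auto
qed

theorem theorem1:
  shows "(\<lambda>(n, r, s). gf_term n r s) summable_on UNIV \<and>
         convergent_prod (\<lambda>j. gf_factor (j + 1)) \<and>
         (\<Sum>\<^sub>\<infinity>(n, r, s)\<in>UNIV. gf_term n r s) = (\<Prod>j. gf_factor (j + 1))"
proof (intro conjI)
  show "(\<lambda>(n, r, s). gf_term n r s) summable_on UNIV"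
    using has_sum_gf_term by (rule has_sum_imp_summable)
  show "convergent_prod (\<lambda>j. gf_factor (j + 1))"
    using has_prod_gf_factor by (auto simp: has_prod_def convergent_prod_def)
  show "(\<Sum>\<^sub>\<infinity>(n, r, s)\<in>UNIV. gf_term n r s) = (\<Prod>j. gf_factor (j + 1))"
    using infsumI[OF has_sum_gf_term] has_prod_unique[OF has_prod_gf_factor] by simp
qed

end
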